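(* Consider the system $$\dot{\mathbf x}=\mathbf f_0(\mathbf x,t)+\mathbf f(\boldsymbol\xi(t),\boldsymbol\theta)-\mathbf f(\boldsymbol\xi(t),\hat{\boldsymbol\theta})+\boldsymbol\varepsilon(t)\qquad(\ast)$$ described in the context, and suppose that the following conditions hold: C4) the vector field $\mathbf f_0(\mathbf x,t)$ satisfies Assumption (O) of the context, with set $\mathcal A$, constant $c$ and functions $\Delta(\cdot)$, $\beta(\cdot)$; C5) there exists a (known) system $\dot{\boldsymbol\lambda}=S(\boldsymbol\lambda)$, $\boldsymbol\lambda(t_0)=\boldsymbol\lambda_0\in\Omega_\lambda$, with $\Omega_\lambda\subset\mathbb R^\lambda$ bounded and $S$ locally Lipschitz, satisfying Assumption (E) of the context; C6) there exists a function $\boldsymbol\eta:\mathbb R^\lambda\to\mathbb R^d$ with $\|\boldsymbol\eta(\boldsymbol\lambda')-\boldsymbol\eta(\boldsymbol\lambda'')\|\le D_\eta\|\boldsymbol\lambda'-\boldsymbol\lambda''\|$ such that the set $\boldsymbol\eta(\Omega_\lambda)$ is dense in $\Omega_\theta$; C7) system $(\ast)$ has steady-state characteristic with respect to the norm $\|\cdot\|_{\mathcal A_{\Delta(M)}}$, $M=2\Delta_f+\Delta_\varepsilon+\delta$, and input $\hat{\boldsymbol\theta}$, where $\delta$ is some positive (arbitrarily small) constant. Consider the interconnection $$\dot{\mathbf x}=\mathbf f_0(\mathbf x,t)+\mathbf f(\boldsymbol\xi(t),\boldsymbol\theta)-\mathbf f(\boldsymbol\xi(t),\hat{\boldsymbol\theta})+\boldsymbol\varepsilon(t),\qquad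 \hat{\boldsymbol\theta}=\boldsymbol\eta(\boldsymbol\lambda),\qquad \dot{\boldsymbol\lambda}=\gamma\,\|\mathbf x(t)\|_{\mathcal A_{\Delta(M)}}\,S(\boldsymbol\lambda),$$ where $\gamma>0$ satisfies $$\gamma\le\Big(\beta^{-1}\Big(\frac{r}{\kappa}\Big)\Big)^{-1}\frac{\kappa-1}{\kappa}\ \frac{1}{D_\lambda\big(\beta(0)\big(1+\frac{\kappa}{1-r}\big)+1\big)},\qquad D_\lambda=c\cdot D_f\cdot D_\eta\cdot\max_{\boldsymbol\lambda\in\Omega_\lambda}\|S(\boldsymbol\lambda)\|,$$ for some $r\in(0,1)$, $\kappa\in(1,\infty)$. Then, for $\boldsymbol\lambda(t_0)=\boldsymbol\lambda_0$, some $\boldsymbol\theta'\in\Omega_\theta$ and all $\mathbf x(t_0)=\mathbf x_0\in\mathbb R^n$ the following holds ($\boldsymbol\theta'$ being allowed to depend on the trajectory): $$\lim_{t\to\infty}\|\mathbf x(t)\|_{\mathcal A_{\Delta(M)}}=0,\qquad\lim_{t\to\infty}\hat{\boldsymbol\theta}(t)=\boldsymbol\theta'\in\Omega_\theta .$$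
   Context: Notation. $\mathbb R_+=[0,\infty)$. For a set $\mathcal A\subset\mathbb R^n$, $\|\mathbf x\|_{\mathcal A}=\inf_{\mathbf q\in\mathcal A}\|\mathbf x-\mathbf q\|$; for $\Delta\in\mathbb R_+$, $\|\mathbf x\|_{\mathcal A_\Delta}=\|\mathbf x\|_{\mathcal A}-\Delta$ if $\|\mathbf x\|_{\mathcal A}>\Delta$ and $\|\mathbf x\|_{\mathcal A_\Delta}=0$ otherwise. $\|f\|_{\infty,[t_0,t]}=\sup_{\tau\in[t_0,t]}\|f(\tau)\|$. $\mathbb R^\lambda$, $\mathbb R^\xi$, $\mathbb R^d$ denote Euclidean spaces of the (finite) dimensions of $\boldsymbol\lambda$, $\boldsymbol\xi$ and $\boldsymbol\theta$. System $(\ast)$. $\mathbf x\in\mathbb R^n$; $\boldsymbol\varepsilon\in L_\infty^n[t_0,\infty]$ is an external perturbation with $\|\boldsymbol\varepsilon(\tau)\|_{\infty,[t_0,t]}\le\Delta_\varepsilon$ for a known $\Delta_\varepsilon$; $\boldsymbol\xi:\mathbb R_+\to\mathbb R^\xi$ is a function of time (possibly including available measurements of the state); $\boldsymbol\theta,\hat{\boldsymbol\theta}\in\Omega_\theta\subset\mathbb R^d$ are the unknown (constant) and the estimated parameters, and $\Omega_\theta$ is bounded. There are known $D_f,\Delta_f\in\mathbb R_+$ with $\|\mathbf f(\boldsymbol\xi(t),\boldsymbol\theta)-\mathbf f(\boldsymbol\xi(t),\hat{\boldsymbol\theta})\|\le D_f\|\boldsymbol\theta-\hat{\boldsymbol\theta}\|+\Delta_f$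 (for parameter values in $\Omega_\theta$, uniformly in $\boldsymbol\xi$). Assumption (O). The system $\dot{\mathbf x}=\mathbf f_0(\mathbf x,t)+\mathbf u(t)$ is forward-complete. Furthermore, there exist a bounded set $\mathcal A$, $c>0$, a function $\Delta:\mathbb R_+\to\mathbb R_+$, and a strictly decreasing function $\beta:\mathbb R_+\to\mathbb R_+$ with $\lim_{t\to\infty}\beta(t)=0$, such that for all $\Delta_u\in\mathbb R_+$ and all $\mathbf u$, $\mathbf u_0$ with $\|\mathbf u\|_{\infty,[t_0,t]}\le\Delta_u+\|\mathbf u_0\|_{\infty,[t_0,t]}$: $\|\mathbf x(t)\|_{\mathcal A_{\Delta(\Delta_u)}}\le\beta(t-t_0)\|\mathbf x(t_0)\|_{\mathcal A_{\Delta(\Delta_u)}}+c\|\mathbf u_0\|_{\infty,[t_0,t]}$ for all $t_0\in\mathbb R_+$, $t\ge t_0$. As standing conventions, $\beta$ is continuous with $\beta(0)\ge1$, and $\beta^{-1}$ is its inverse. Assumption (E). The system $\dot{\boldsymbol\lambda}=S(\boldsymbol\lambda)$ is Poisson stable in $\Omega_\lambda$: for all $\boldsymbol\lambda'\in\Omega_\lambda$, $t'\in\mathbb R_+$ and every (arbitrarily small) $\epsilon>0$ there is $t''>t'$ with $\|\boldsymbol\lambda(t'',\boldsymbol\lambda')-\boldsymbol\lambda'\|\le\epsilon$. Moreover, the trajectory $\boldsymbol\lambda(t,\boldsymbol\lambda_0)$ is dense in $\Omega_\lambda$: for all $\boldsymbol\lambda'\in\Omega_\lambda$, $\epsilon>0$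 there is $t\in\mathbb R_+$ with $\|\boldsymbol\lambda'-\boldsymbol\lambda(t,\boldsymbol\lambda_0)\|<\epsilon$. Steady-state characteristic (C7): there is a set-valued map $\chi$ from parameter values to subsets of $\mathbb R_+$ such that for each constant $\bar{\boldsymbol\theta}$ and every input $\hat{\boldsymbol\theta}(t)$ with $\lim_{t\to\infty}\hat{\boldsymbol\theta}(t)=\bar{\boldsymbol\theta}$, the limit $\lim_{t\to\infty}\|\mathbf x(t)\|_{\mathcal A_{\Delta(M)}}$ along the solutions of $(\ast)$ exists and belongs to $\chi(\bar{\boldsymbol\theta})$. *)

theory Defs
  imports "HOL-Analysis.Analysis"
begin

text \<open>Distance to the \<open>d\<close>-inflated set: \<open>\<parallel>x\<parallel>\<close> with subscript \<open>A\<^sub>\<Delta>\<close>, where \<open>\<Delta> = d\<close>.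
  Only used for nonempty \<open>A\<close> (\<^const>\<open>infdist\<close> is \<open>0\<close> for the empty set).\<close>

definition norm_beyond :: "'a::metric_space set \<Rightarrow> real \<Rightarrow> 'a \<Rightarrow> real" where
  "norm_beyond A d x = (if infdist x A > d then infdist x A - d else 0)"

text \<open>Extended-real valued, so that unbounded functions have norm \<open>\<infinity>\<close>.\<close>

definition sup_norm :: "(real \<Rightarrow> 'a::real_normed_vector) \<Rightarrow> real \<Rightarrow> real \<Rightarrow> ereal" where
  "sup_norm g s t = (SUP \<tau>\<in>{s..t}. ereal (norm (g \<tau>)))"

definition L_infty :: "real \<Rightarrow> (real \<Rightarrow> 'a::euclidean_space) \<Rightarrow> bool" where
  "L_infty s g \<longleftrightarrow> g \<in> borel_measurable (lebesgue_on {s..}) \<and>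
     (\<exists>B. AE \<tau> in lebesgue_on {s..}. norm (g \<tau>) \<le> B)"

text \<open>Solutions on the interval \<open>I\<close> of \<open>x' = F t x\<close> in the sense of Caratheodory (inputs are merely
  measurable): \<open>x\<close> is locally absolutely continuous and satisfies the equation almost everywhere,
  written as an integral equation.\<close>

definition solution_on :: "real set \<Rightarrow> (real \<Rightarrow> 'a::euclidean_space \<Rightarrow> 'a) \<Rightarrow> (real \<Rightarrow> 'a) \<Rightarrow> bool" where
  "solution_on I F x \<longleftrightarrow> (\<forall>a\<in>I. \<forall>b\<in>I. a \<le> b \<longrightarrow>
     (\<lambda>\<tau>. F \<tau> (x \<tau>)) absolutely_integrable_on {a..b} \<and>
     x b = x a + integral {a..b} (\<lambda>\<tau>. F \<tau> (x \<tau>)))"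

text \<open>Every initial value problem with an essentially bounded input is solvable on the whole half-line,
  and no solution is confined to a finite interval.\<close>

definition forward_complete :: "('a::euclidean_space \<Rightarrow> real \<Rightarrow> 'a) \<Rightarrow> bool" where
  "forward_complete f0 \<longleftrightarrow> (\<forall>s\<ge>0. \<forall>u. L_infty s u \<longrightarrow>
     (\<forall>x0. \<exists>x. x s = x0 \<and> solution_on {s..} (\<lambda>t y. f0 y t + u t) x) \<and>
     (\<forall>T>s. \<forall>y. solution_on {s..<T} (\<lambda>t z. f0 z t + u t) y \<longrightarrow>
        (\<exists>x. solution_on {s..} (\<lambda>t z. f0 z t + u t) x \<and> (\<forall>t\<in>{s..<T}. x t = y t))))"

text \<open>The functions \<open>\<Delta>\<close> and \<open>\<beta>\<close> map the nonnegative reals to themselves; their values at negative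
  arguments are irrelevant.\<close>

definition input_output_stable ::
    "('a::euclidean_space \<Rightarrow> real \<Rightarrow> 'a) \<Rightarrow> 'a set \<Rightarrow> real \<Rightarrow> (real \<Rightarrow> real) \<Rightarrow> (real \<Rightarrow> real) \<Rightarrow> bool" where
  "input_output_stable f0 A c \<Delta> \<beta> \<longleftrightarrow>
     forward_complete f0 \<and>
     bounded A \<and> A \<noteq> {} \<and> c > 0 \<and> (\<forall>d\<ge>0. \<Delta> d \<ge> 0) \<and>
     (\<forall>t\<ge>0. \<beta> t \<ge> 0) \<and> strict_antimono_on {0..} \<beta> \<and> (\<beta> \<longlongrightarrow> 0) at_top \<and>
     continuous_on {0..} \<beta> \<and> \<beta> 0 \<ge> 1 \<and>
     (\<forall>d\<ge>0. \<forall>s\<ge>0. \<forall>t\<ge>s. \<forall>(u :: real \<Rightarrow> 'a) (u0 :: real \<Rightarrow> 'a) x.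
        solution_on {s..} (\<lambda>\<tau> y. f0 y \<tau> + u \<tau>) x \<longrightarrow>
        sup_norm u s t \<le> ereal d + sup_norm u0 s t \<longrightarrow>
        ereal (norm_beyond A (\<Delta> d) (x t))
          \<le> ereal (\<beta> (t - s) * norm_beyond A (\<Delta> d) (x s)) + ereal c * sup_norm u0 s t)"

text \<open>Here \<open>\<phi> t l\<close> is the state of \<open>l' = S l\<close> after elapsed time \<open>t\<close> when started
  at \<open>l\<close>; it is determined by \<open>S\<close> when \<open>S\<close> is locally Lipschitz. That a trajectory is dense in
  \<open>\<Omega>\<close> includes that it lies in \<open>\<Omega>\<close>.\<close>

definition poisson_stable_dense ::
    "('l::euclidean_space \<Rightarrow> 'l) \<Rightarrow> (real \<Rightarrow> 'l \<Rightarrow> 'l) \<Rightarrow> 'l set \<Rightarrow> 'l \<Rightarrow> bool" where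
  "poisson_stable_dense S \<phi> \<Omega> l0 \<longleftrightarrow>
     (\<forall>l\<in>\<Omega>. \<phi> 0 l = l \<and> solution_on {0..} (\<lambda>_. S) (\<lambda>t. \<phi> t l)) \<and>
     (\<forall>l\<in>\<Omega>. \<forall>t'\<ge>0. \<forall>e>0. \<exists>t''>t'. norm (\<phi> t'' l - l) \<le> e) \<and>
     (\<forall>t\<ge>0. \<phi> t l0 \<in> \<Omega>) \<and>
     (\<forall>l\<in>\<Omega>. \<forall>e>0. \<exists>t\<ge>0. norm (l - \<phi> t l0) < e)"

definition dense_in :: "'a::topological_space set \<Rightarrow> 'a set \<Rightarrow> bool" where
  "dense_in D X \<longleftrightarrow> D \<subseteq> X \<and> X \<subseteq> closure D"

text \<open>Solutions \<open>x\<close> of \<open>x' = f0 x t + f (\<xi> t) \<theta> - f (\<xi> t) (\<theta>h t) + \<epsilon> t\<close> on \<open>[t0, \<infinity>)\<close> for the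
  input \<open>\<theta>h\<close>. The signal \<open>\<xi>\<close> is a function of time that may contain measurements of the
  state, hence it may depend on the solution: it is \<open>\<xi> x\<close>. A pure time signal is the case where
  \<open>\<xi>\<close> ignores its first argument.\<close>

definition plant_solution ::
    "('a::euclidean_space \<Rightarrow> real \<Rightarrow> 'a) \<Rightarrow> ('k \<Rightarrow> 'd \<Rightarrow> 'a) \<Rightarrow> ((real \<Rightarrow> 'a) \<Rightarrow> real \<Rightarrow> 'k) \<Rightarrow>
     'd \<Rightarrow> (real \<Rightarrow> 'a) \<Rightarrow> real \<Rightarrow> (real \<Rightarrow> 'd) \<Rightarrow> (real \<Rightarrow> 'a) \<Rightarrow> bool" where
  "plant_solution f0 f \<xi> \<theta> \<epsilon> t0 \<theta>h x \<longleftrightarrow>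
     solution_on {t0..} (\<lambda>t y. f0 y t + f (\<xi> x t) \<theta> - f (\<xi> x t) (\<theta>h t) + \<epsilon> t) x"

text \<open>Here \<open>sol \<theta>h x\<close> says that \<open>x\<close> is a solution for the input \<open>\<theta>h\<close> from time \<open>t0\<close> on, and
  \<open>N\<close> is the norm; parameter values and inputs range over \<open>\<Omega>\<close>.\<close>

definition has_steady_state_characteristic ::
    "((real \<Rightarrow> 'd::topological_space) \<Rightarrow> (real \<Rightarrow> 'a) \<Rightarrow> bool) \<Rightarrow> real \<Rightarrow> 'd set \<Rightarrow> ('a \<Rightarrow> real) \<Rightarrow> bool" where
  "has_steady_state_characteristic sol t0 \<Omega> N \<longleftrightarrow>
     (\<exists>ss. (\<forall>p\<in>\<Omega>. ss p \<subseteq> {0..}) \<and>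
        (\<forall>p\<in>\<Omega>. \<forall>\<theta>h. (\<forall>t\<ge>t0. \<theta>h t \<in> \<Omega>) \<longrightarrow> (\<theta>h \<longlongrightarrow> p) at_top \<longrightarrow>
           (\<forall>x. sol \<theta>h x \<longrightarrow> (\<exists>y\<in>ss p. ((\<lambda>t. N (x t)) \<longlongrightarrow> y) at_top))))"

end

theory Submission
  imports Defs
begin

text \<open>The search for the parameter is one-dimensional. The system \<open>l' = \<gamma> N(t) S(l)\<close>, where \<open>N(t)\<close> is
  the error \<open>\<parallel>x(t)\<parallel>\<close> measured beyond the inflated set, is the flow of \<open>S\<close> run on a rescaled
  clock: \<open>l(t) = \<phi>(\<sigma>(t), l0)\<close> with \<open>\<sigma>(t) = \<gamma> \<integral> N\<close> (\<open>time_scaled_ode_solution_eq_flow\<close>). So everything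
  follows once the clock \<open>\<sigma>\<close> is known to be bounded. A bounded nondecreasing clock converges, hence so
  does the estimate \<open>\<eta>(l(t))\<close>, and its limit lies in the parameter set because the orbit of \<open>l0\<close> stays
  in \<open>\<Omega>\<^sub>l\<close>; the steady-state characteristic then makes \<open>N\<close> converge, and the limit is zero because
  \<open>\<integral> N\<close> is finite.

  To bound the clock, choose a reading \<open>\<sigma>*\<close> at which the estimate would be so close to the true
  parameter that the remaining mismatch is absorbed by \<open>\<delta>\<close>. By density and Poisson stability such
  readings occur arbitrarily late (\<open>poisson_stable_dense_recurrent\<close>). Let \<open>h = \<sigma>* - \<sigma>\<close> be the distance
  still to go. The speed of the flow on \<open>\<Omega>\<^sub>l\<close> and the Lipschitz constants turn input-output stability
  into
    \<open>N(t) \<le> \<beta>(t - a) N(a) + D h(a)\<close>  as long as \<open>h(t) \<ge> 0\<close>,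
  while \<open>h' = - \<gamma> N\<close>. This is a loop in which the error is driven by \<open>h\<close>, and \<open>h\<close> is a budget that
  the error spends. The condition on \<open>\<gamma>\<close> makes the spending so slow that each reduction of \<open>h\<close> by the
  factor \<open>\<kappa>\<close> takes at least the time \<open>T\<close> after which \<open>\<beta>\<close> has dropped to \<open>r / \<kappa>\<close>. During that time the
  error shrinks along with \<open>h\<close>, so the situation repeats itself and \<open>h\<close> never reaches zero
  (\<open>small_gain_budget_not_exhausted\<close>). The initial error can be arbitrarily large: it only has
  to be small compared with \<open>h(t0) = \<sigma>*\<close>, and \<open>\<sigma>*\<close> may be chosen as late as desired.\<close>


section \<open>The distance beyond a set\<close>

lemma norm_beyond_nonneg: "0 \<le> norm_beyond A d x"
  by (simp add: norm_beyond_def)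

lemma continuous_on_norm_beyond:
  assumes "continuous_on T x"
  shows "continuous_on T (\<lambda>t. norm_beyond A d (x t))"
proof -
  have eq: "norm_beyond A d (x t) = max 0 (infdist (x t) A - d)" for t
    by (simp add: norm_beyond_def)
  show ?thesis
    unfolding eq
    by (intro continuous_on_max continuous_on_diff continuous_on_infdist continuous_on_const assms)
qed

section \<open>Caratheodory solutions with continuous right-hand side\<close>

lemma solution_on_subset: "solution_on I F x \<Longrightarrow> J \<subseteq> I \<Longrightarrow> solution_on J F x"
  unfolding solution_on_def by blast

lemma solution_onD:
  assumes "solution_on I F x" "a \<in> I" "b \<in> I" "a \<le> b"
  shows "(\<lambda>\<tau>. F \<tau> (x \<tau>)) absolutely_integrable_on {a..b}"
    and "x b = x a + integral {a..b} (\<lambda>\<tau>. F \<tau> (x \<tau>))"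
  using assms unfolding solution_on_def by blast+

lemma at_within_atLeast_eq_Icc:
  fixes t :: real
  assumes "t < b"
  shows "at t within {s..} = at t within {s..b}"
  by (rule at_within_nhd[where S="{..<b}"]) (use assms in auto)

lemma solution_on_continuous_on:
  assumes "solution_on {s..} F x"
  shows "continuous_on {s..} x"
  unfolding continuous_on_eq_continuous_within
proof
  fix t assume t: "t \<in> {s..}"
  have x: "x u = x s + integral {s..u} (\<lambda>\<tau>. F \<tau> (x \<tau>))" if "u \<in> {s..t + 1}" for u
    using solution_onD(2)[OF assms, of s u] that by (simp only: atLeast_iff atLeastAtMost_iff order_refl)
  have "(\<lambda>\<tau>. F \<tau> (x \<tau>)) integrable_on {s..t + 1}"
    using solution_onD(1)[OF assms, of s "t + 1"] t
    by (intro set_lebesgue_integral_eq_integral(1)) auto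
  then have "continuous_on {s..t + 1} (\<lambda>u. x s + integral {s..u} (\<lambda>\<tau>. F \<tau> (x \<tau>)))"
    by (intro continuous_intros indefinite_integral_continuous_1)
  then have "continuous_on {s..t + 1} x"
    using x by (metis (mono_tags, lifting) continuous_on_cong)
  then show "continuous (at t within {s..}) x"
    using t at_within_atLeast_eq_Icc[of t "t + 1" s]
    by (simp add: continuous_on_eq_continuous_within)
qed

lemma indefinite_integral_has_vector_derivative_atLeast:
  fixes g :: "real \<Rightarrow> 'a::banach"
  assumes "continuous_on {s..} g" and "s \<le> t"
  shows "((\<lambda>u. integral {s..u} g) has_vector_derivative g t) (at t within {s..})"
proof -
  have "continuous_on {s..t + 1} g"
    by (rule continuous_on_subset[OF assms(1)]) auto
  then show ?thesis
    using integral_has_vector_derivative[of s "t + 1" g t] assms(2)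
      at_within_atLeast_eq_Icc[of t "t + 1" s] by simp
qed

text \<open>Caratheodory solutions are classical ones whenever the right-hand side is continuous along them.
  This applies to the equation for \<open>l\<close>, where the clock rate is continuous, but not to the
  plant, whose perturbation is merely measurable.\<close>

lemma solution_on_has_vector_derivative:
  assumes sol: "solution_on {s..} F x"
    and cont: "continuous_on {s..} (\<lambda>t. F t (x t))" and "s \<le> t"
  shows "(x has_vector_derivative F t (x t)) (at t within {s..})"
proof -
  have d: "((\<lambda>u. x s + integral {s..u} (\<lambda>\<tau>. F \<tau> (x \<tau>))) has_vector_derivative F t (x t))
          (at t within {s..})"
    using indefinite_integral_has_vector_derivative_atLeast[OF cont \<open>s \<le> t\<close>]
    by (auto intro!: derivative_eq_intros)
  have x: "x u = x s + integral {s..u} (\<lambda>\<tau>. F \<tau> (x \<tau>))" if "u \<in> {s..}" for u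
    using solution_onD(2)[OF sol, of s u] that by (simp only: atLeast_iff order_refl)
  have "t \<in> {s..}" using \<open>s \<le> t\<close> by simp
  from has_vector_derivative_transform[OF this x d] show ?thesis .
qed

text \<open>A Gronwall argument: on a compact interval both curves stay in a compact set, on which \<open>S\<close> has a
  Lipschitz constant \<open>L\<close>; with \<open>\<bar>g\<bar> \<le> G\<close> the squared distance of the curves then grows at most like
  \<open>exp (2 G L t)\<close>, and it starts at zero.\<close>

lemma time_scaled_ode_unique:
  fixes y z :: "real \<Rightarrow> 'a::euclidean_space"
  assumes lip: "local_lipschitz (UNIV :: real set) UNIV (\<lambda>_. S)"
    and g: "continuous_on {s..} g"
    and dy: "\<And>t. s \<le> t \<Longrightarrow> (y has_vector_derivative g t *\<^sub>R S (y t)) (at t within {s..})"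
    and dz: "\<And>t. s \<le> t \<Longrightarrow> (z has_vector_derivative g t *\<^sub>R S (z t)) (at t within {s..})"
    and init: "y s = z s" and "s \<le> b"
  shows "y b = z b"
proof -
  define I where "I = {s..b}"
  have sub: "I \<subseteq> {s..}" and comp: "compact I"
    by (auto simp: I_def)
  have cy: "continuous_on I y" and cz: "continuous_on I z"
    using dy dz sub
    by (meson atLeast_iff continuous_on_eq_continuous_within continuous_on_subset
        has_vector_derivative_continuous)+
  define K where "K = y ` I \<union> z ` I"
  have "compact K"
    unfolding K_def using cy cz comp by (intro compact_Un compact_continuous_image)
  then obtain L where L: "L-lipschitz_on K S"
    using local_lipschitz_compact_implies_lipschitz
            [OF local_lipschitz_subset[OF lip], of "{0}" K] by auto
  obtain G where G: "\<And>t. t \<in> I \<Longrightarrow> \<bar>g t\<bar> \<le> G"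
    using compact_imp_bounded[OF compact_continuous_image[OF continuous_on_subset[OF g sub] comp]]
    by (auto simp: bounded_iff)
  define C where "C = 2 * (G * L)"
  define w where "w t = (y t - z t) \<bullet> (y t - z t)" for t
  \<comment> \<open>The weight compensates the growth of the squared distance \<open>w\<close>, so that \<open>v\<close> is nonincreasing.\<close>
  define v where "v t = exp (- (C * t)) * w t" for t
  have "v b \<le> v s"
  proof (rule DERIV_nonpos_imp_decreasing_open[OF \<open>s \<le> b\<close>])
    show "continuous_on {s..b} v"
      unfolding v_def w_def using cy cz by (auto simp: I_def intro!: continuous_intros)
    fix t assume t: "s < t" "t < b"
    define q where "q = g t *\<^sub>R (S (y t) - S (z t))"
    have at: "at t within {s..} = at t"
      using t at_within_interior[of t "{s..}"] by simp
    have "((\<lambda>t. y t - z t) has_vector_derivative q) (at t)"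
      using has_vector_derivative_diff[OF dy dz, of t] t at by (simp add: q_def algebra_simps)
    then have d: "((\<lambda>t. y t - z t) has_derivative (\<lambda>h. h *\<^sub>R q)) (at t)"
      by (simp add: has_vector_derivative_def)
    have "(w has_real_derivative 2 * ((y t - z t) \<bullet> q)) (at t)"
      unfolding has_field_derivative_def w_def
      by (rule derivative_eq_intros d refl)+ (auto simp: inner_commute)
    then have "(v has_real_derivative exp (- (C * t)) *
        (2 * ((y t - z t) \<bullet> q) - C * w t)) (at t)"
      unfolding v_def by (auto intro!: derivative_eq_intros simp: algebra_simps)
    moreover have "2 * ((y t - z t) \<bullet> q) \<le> C * w t"
    proof -
      have tI: "t \<in> I" using t by (simp add: I_def)
      then have "norm (S (y t) - S (z t)) \<le> L * norm (y t - z t)"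
        using lipschitz_onD[OF L, of "y t" "z t"] by (simp add: K_def dist_norm)
      then have "norm q \<le> G * (L * norm (y t - z t))"
        unfolding q_def norm_scaleR using G[OF tI] abs_ge_zero[of "g t"]
        by (intro mult_mono) auto
      then have "(y t - z t) \<bullet> q \<le> norm (y t - z t) * (G * (L * norm (y t - z t)))"
        by (meson mult_left_mono norm_cauchy_schwarz norm_ge_zero order_trans)
      then show ?thesis
        by (simp add: C_def w_def power2_norm_eq_inner[symmetric] power2_eq_square algebra_simps)
    qed
    ultimately show "\<exists>d. (v has_real_derivative d) (at t) \<and> d \<le> 0"
      by (intro exI conjI) (auto intro: mult_nonneg_nonpos)
  qed
  then have "(y b - z b) \<bullet> (y b - z b) \<le> 0"
    using init by (simp add: v_def w_def mult_le_0_iff)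
  then have "(y b - z b) \<bullet> (y b - z b) = 0"
    by (rule order_antisym) (rule inner_ge_zero)
  then show ?thesis
    by simp
qed

section \<open>Poisson stable flows and changes of clock\<close>

lemma poisson_stable_dense_flow_deriv:
  assumes lip: "local_lipschitz (UNIV :: real set) UNIV (\<lambda>_. S)"
    and psd: "poisson_stable_dense S \<phi> \<Omega> l0" and "l \<in> \<Omega>" and "0 \<le> t"
  shows "((\<lambda>t. \<phi> t l) has_vector_derivative S (\<phi> t l)) (at t within {0..})"
proof -
  have sol: "solution_on {0..} (\<lambda>_. S) (\<lambda>t. \<phi> t l)"
    using psd \<open>l \<in> \<Omega>\<close> by (simp add: poisson_stable_dense_def)
  have "continuous_on UNIV S"
    using local_lipschitz_continuous_on[OF lip] by simp
  then have "continuous_on {0..} (\<lambda>t. S (\<phi> t l))"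
    using continuous_on_compose2[OF _ solution_on_continuous_on[OF sol]] by auto
  from solution_on_has_vector_derivative[OF sol this \<open>0 \<le> t\<close>] show ?thesis .
qed

text \<open>The semigroup law is needed because Poisson stability speaks of the trajectories of all points of
  \<open>\<Omega>\<close>, whereas the density of the orbit and the search concern the trajectory of \<open>l0\<close> alone.\<close>

lemma poisson_stable_dense_flow_add:
  assumes lip: "local_lipschitz (UNIV :: real set) UNIV (\<lambda>_. S)"
    and psd: "poisson_stable_dense S \<phi> \<Omega> l0" and "l0 \<in> \<Omega>" and "0 \<le> a" "0 \<le> t"
  shows "\<phi> (t + a) l0 = \<phi> t (\<phi> a l0)"
proof (rule time_scaled_ode_unique[OF lip, where g="\<lambda>_. 1" and s=0
      and y="\<lambda>t. \<phi> (t + a) l0" and z="\<lambda>t. \<phi> t (\<phi> a l0)"])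
  note deriv = poisson_stable_dense_flow_deriv[OF lip psd]
  have a: "\<phi> a l0 \<in> \<Omega>"
    using psd \<open>0 \<le> a\<close> by (simp add: poisson_stable_dense_def)
  show "((\<lambda>t. \<phi> (t + a) l0) has_vector_derivative 1 *\<^sub>R S (\<phi> (u + a) l0)) (at u within {0..})"
    if "0 \<le> u" for u
  proof -
    have "((\<lambda>t. t + a) has_vector_derivative 1) (at u within {0..})"
      by (auto intro!: derivative_eq_intros)
    moreover have "((\<lambda>t. \<phi> t l0) has_vector_derivative S (\<phi> (u + a) l0))
        (at (u + a) within (\<lambda>t. t + a) ` {0..})"
      by (rule has_vector_derivative_within_subset[OF deriv[OF \<open>l0 \<in> \<Omega>\<close>]])
        (use that \<open>0 \<le> a\<close> in auto)
    ultimately show ?thesis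
      using vector_diff_chain_within by (fastforce simp: o_def)
  qed
  show "((\<lambda>t. \<phi> t (\<phi> a l0)) has_vector_derivative 1 *\<^sub>R S (\<phi> u (\<phi> a l0))) (at u within {0..})"
    if "0 \<le> u" for u
    using deriv[OF a that] by simp
  show "\<phi> (0 + a) l0 = \<phi> 0 (\<phi> a l0)"
    using psd a by (simp add: poisson_stable_dense_def)
qed (use \<open>0 \<le> t\<close> in auto)

text \<open>Density provides one visit near \<open>p\<close>, possibly an early one. The visited point belongs to \<open>\<Omega>\<close>
  itself, so Poisson stability brings its trajectory back to it after an arbitrarily long time.\<close>

lemma poisson_stable_dense_recurrent:
  assumes lip: "local_lipschitz (UNIV :: real set) UNIV (\<lambda>_. S)"
    and psd: "poisson_stable_dense S \<phi> \<Omega> l0" and "l0 \<in> \<Omega>" and "p \<in> \<Omega>" and "0 < e"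
  obtains t where "H \<le> t" "0 \<le> t" "norm (\<phi> t l0 - p) < e"
proof -
  obtain a where a: "0 \<le> a" "norm (p - \<phi> a l0) < e / 2"
    using psd \<open>p \<in> \<Omega>\<close> half_gt_zero[OF \<open>0 < e\<close>] unfolding poisson_stable_dense_def by blast
  have "\<phi> a l0 \<in> \<Omega>"
    using psd a(1) by (simp add: poisson_stable_dense_def)
  then obtain b where b: "max 0 H < b" "norm (\<phi> b (\<phi> a l0) - \<phi> a l0) \<le> e / 2"
    using psd half_gt_zero[OF \<open>0 < e\<close>] unfolding poisson_stable_dense_def
    by (metis max.cobounded1)
  show ?thesis
  proof
    show "H \<le> b + a" "0 \<le> b + a" using a b by auto
    have "norm (\<phi> (b + a) l0 - p) \<le> norm (\<phi> b (\<phi> a l0) - \<phi> a l0) + norm (p - \<phi> a l0)"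
      using poisson_stable_dense_flow_add[OF lip psd \<open>l0 \<in> \<Omega>\<close> a(1), of b] b(1)
        norm_triangle_ineq4[of "\<phi> b (\<phi> a l0) - \<phi> a l0" "p - \<phi> a l0"] by simp
    then show "norm (\<phi> (b + a) l0 - p) < e" using a b by simp
  qed
qed

text \<open>By the chain rule, the flow read on the clock with rate \<open>g\<close> solves the time-scaled equation;
  uniqueness identifies it with \<open>l\<close>.\<close>

lemma time_scaled_ode_solution_eq_flow:
  assumes lip: "local_lipschitz (UNIV :: real set) UNIV (\<lambda>_. S)"
    and psd: "poisson_stable_dense S \<phi> \<Omega> l0" and "l0 \<in> \<Omega>"
    and g: "continuous_on {s..} g" "\<And>t. s \<le> t \<Longrightarrow> 0 \<le> g t"
    and sol: "solution_on {s..} (\<lambda>t y. g t *\<^sub>R S y) l" and "l s = l0" and "s \<le> t"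
  shows "l t = \<phi> (integral {s..t} g) l0"
proof (rule time_scaled_ode_unique[OF lip g(1) _ _ _ \<open>s \<le> t\<close>,
      where y=l and z="\<lambda>t. \<phi> (integral {s..t} g) l0"])
  have "continuous_on UNIV S"
    using local_lipschitz_continuous_on[OF lip] by simp
  then have "continuous_on {s..} (\<lambda>t. g t *\<^sub>R S (l t))"
    by (intro continuous_intros g continuous_on_compose2[OF _ solution_on_continuous_on[OF sol]]) auto
  from solution_on_has_vector_derivative[OF sol this]
  show "(l has_vector_derivative g u *\<^sub>R S (l u)) (at u within {s..})" if "s \<le> u" for u
    using that .
  show "((\<lambda>t. \<phi> (integral {s..t} g) l0) has_vector_derivative
      g u *\<^sub>R S (\<phi> (integral {s..u} g) l0)) (at u within {s..})" if "s \<le> u" for u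
  proof -
    have pos: "0 \<le> integral {s..v} g" for v
      using g by (intro integral_nonneg integrable_continuous_real)
        (auto intro: continuous_on_subset)
    have "((\<lambda>t. \<phi> t l0) has_vector_derivative S (\<phi> (integral {s..u} g) l0))
        (at (integral {s..u} g) within (\<lambda>v. integral {s..v} g) ` {s..})"
      by (rule has_vector_derivative_within_subset
          [OF poisson_stable_dense_flow_deriv[OF lip psd \<open>l0 \<in> \<Omega>\<close> pos]]) (use pos in auto)
    from vector_diff_chain_within[OF indefinite_integral_has_vector_derivative_atLeast[OF g(1) that] this]
    show ?thesis by (simp add: o_def)
  qed
  show "l s = \<phi> (integral {s..s} g) l0"
    using psd \<open>l0 \<in> \<Omega>\<close> \<open>l s = l0\<close> by (simp add: poisson_stable_dense_def)
qed

lemma poisson_stable_dense_flow_speed: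
  assumes lip: "local_lipschitz (UNIV :: real set) UNIV (\<lambda>_. S)"
    and psd: "poisson_stable_dense S \<phi> \<Omega> l0" and "l0 \<in> \<Omega>"
    and V: "\<And>l. l \<in> \<Omega> \<Longrightarrow> norm (S l) \<le> V" and "0 \<le> a" "a \<le> b"
  shows "norm (\<phi> b l0 - \<phi> a l0) \<le> V * (b - a)"
proof -
  have sol: "solution_on {0..} (\<lambda>_. S) (\<lambda>t. \<phi> t l0)"
    and orbit: "\<And>t. 0 \<le> t \<Longrightarrow> \<phi> t l0 \<in> \<Omega>"
    using psd \<open>l0 \<in> \<Omega>\<close> by (auto simp: poisson_stable_dense_def)
  have "continuous_on UNIV S"
    using local_lipschitz_continuous_on[OF lip] by simp
  then have "continuous_on {a..b} (\<lambda>t. S (\<phi> t l0))"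
    by (rule continuous_on_compose2[OF _ continuous_on_subset[OF solution_on_continuous_on[OF sol]]])
      (use \<open>0 \<le> a\<close> in auto)
  from integral_bound[OF \<open>a \<le> b\<close> this, of V]
  have "norm (integral {a..b} (\<lambda>t. S (\<phi> t l0))) \<le> V * (b - a)"
    using V orbit \<open>0 \<le> a\<close> by auto
  moreover have "\<phi> b l0 = \<phi> a l0 + integral {a..b} (\<lambda>t. S (\<phi> t l0))"
    using solution_onD(2)[OF sol, of a b] assms(5,6) by auto
  ultimately show ?thesis by (metis add_diff_cancel_left')
qed

section \<open>Input-output stability for pointwise bounds\<close>

lemma sup_norm_const: "s \<le> t \<Longrightarrow> sup_norm (\<lambda>_. v) s t = ereal (norm v)"
  using SUP_const[of "{s..t}" "ereal (norm v)"] by (simp add: sup_norm_def)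

text \<open>The comparison input \<open>u0\<close> of the stability assumption enters only through its norm, so a constant
  vector of length \<open>m\<close> suffices.\<close>

lemma input_output_stable_estimate:
  fixes x :: "real \<Rightarrow> 'a::euclidean_space"
  assumes ios: "input_output_stable f0 A c \<Delta> \<beta>"
    and sol: "solution_on {s..} (\<lambda>t y. f0 y t + u t) x"
    and u: "\<And>\<tau>. \<tau> \<in> {s..t} \<Longrightarrow> norm (u \<tau>) \<le> d + m"
    and "0 \<le> d" "0 \<le> m" "0 \<le> s" "s \<le> t"
  shows "norm_beyond A (\<Delta> d) (x t) \<le> \<beta> (t - s) * norm_beyond A (\<Delta> d) (x s) + c * m"
proof -
  define v :: 'a where "v = m *\<^sub>R (SOME e. e \<in> Basis)"
  have v: "sup_norm (\<lambda>_. v) s t = ereal m"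
    using \<open>0 \<le> m\<close> \<open>s \<le> t\<close> by (simp add: sup_norm_const v_def SOME_Basis)
  have "sup_norm u s t \<le> ereal d + sup_norm (\<lambda>_. v) s t"
    unfolding v unfolding sup_norm_def by (rule SUP_least) (use u in auto)
  moreover from ios have "\<forall>d\<ge>0. \<forall>s\<ge>0. \<forall>t\<ge>s. \<forall>(u :: real \<Rightarrow> 'a) (u0 :: real \<Rightarrow> 'a) x.
        solution_on {s..} (\<lambda>\<tau> y. f0 y \<tau> + u \<tau>) x \<longrightarrow>
        sup_norm u s t \<le> ereal d + sup_norm u0 s t \<longrightarrow>
        ereal (norm_beyond A (\<Delta> d) (x t))
          \<le> ereal (\<beta> (t - s) * norm_beyond A (\<Delta> d) (x s)) + ereal c * sup_norm u0 s t"
    unfolding input_output_stable_def by (elim conjE)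
  ultimately have "ereal (norm_beyond A (\<Delta> d) (x t))
      \<le> ereal (\<beta> (t - s) * norm_beyond A (\<Delta> d) (x s)) + ereal c * sup_norm (\<lambda>_. v) s t"
    using sol assms(4,6,7) by simp
  then show ?thesis unfolding v by simp
qed

section \<open>The small-gain argument\<close>

text \<open>Here \<open>N\<close> is the error and \<open>h\<close> the budget it spends at rate at most \<open>\<gamma> N\<close>. Put \<open>K = 1 + \<kappa> / (1 - r)\<close> and
  consider the times at which \<open>h\<close> has fallen to \<open>h s / \<kappa> ^ i\<close>. The invariant at these times is
  \<open>N \<le> K D h\<close>. From such a time \<open>a\<close> on, until the next one, \<open>N \<le> (\<beta> 0 K + 1) D h(a)\<close>; since the amount
  \<open>((\<kappa> - 1) / \<kappa>) h(a)\<close> has to be spent, the bound on \<open>\<gamma>\<close> says exactly that this takes at least the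
  time \<open>T\<close>. Then \<open>\<beta>\<close> contributes a factor of at most \<open>r / \<kappa>\<close>, and because \<open>h\<close> falls by the
  factor \<open>\<kappa>\<close> the invariant is reproduced: \<open>r K + \<kappa> \<le> K\<close>. If \<open>h\<close> were exhausted at some finite time,
  all these times would precede it, although consecutive ones are at least \<open>T\<close> apart.\<close>

lemma small_gain_budget_not_exhausted:
  fixes N h \<beta> :: "real \<Rightarrow> real"
  assumes h: "continuous_on {s..} h" "antimono_on {s..} h" "0 < h s"
    and spend: "\<And>a b m. \<lbrakk>s \<le> a; a \<le> b; \<And>t. t \<in> {a..b} \<Longrightarrow> N t \<le> m\<rbrakk>
                  \<Longrightarrow> h a - h b \<le> \<gamma> * (m * (b - a))"
    and est: "\<And>a t. \<lbrakk>s \<le> a; a \<le> t; 0 \<le> h t\<rbrakk> \<Longrightarrow> N t \<le> \<beta> (t - a) * N a + D * h a"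
    and N: "\<And>t. 0 \<le> N t" "N s \<le> D * h s"
    and \<beta>: "antimono_on {0..} \<beta>" "0 \<le> \<beta> 0" "\<beta> T = r / \<kappa>" and T: "0 < T"
    and r: "0 < r" "r < 1" and \<kappa>: "1 < \<kappa>" and D: "0 < D" and \<gamma>: "0 < \<gamma>"
      "\<gamma> \<le> inverse T * ((\<kappa> - 1) / \<kappa>) * (1 / (D * (\<beta> 0 * (1 + \<kappa> / (1 - r)) + 1)))"
    and "s \<le> t"
  shows "0 < h t"
proof (rule ccontr)
  assume "\<not> 0 < h t"
  define K where "K = 1 + \<kappa> / (1 - r)"
  have K: "1 \<le> K" "r * K + \<kappa> \<le> K"
  proof -
    show "1 \<le> K" using r \<kappa> by (simp add: K_def)
    have "K - (r * K + \<kappa>) = (1 - r) * K - \<kappa>" by (simp add: algebra_simps)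
    also have "\<dots> = 1 - r" using r by (simp add: K_def field_simps)
    finally show "r * K + \<kappa> \<le> K" using r by simp
  qed
  define E where "E = \<beta> 0 * K + 1"
  have E: "0 < E" using K \<beta>(2) by (simp add: E_def add_nonneg_pos)
  have \<gamma>T: "\<gamma> * (D * E) * T \<le> (\<kappa> - 1) / \<kappa>"
  proof -
    have "\<gamma> \<le> ((\<kappa> - 1) / \<kappa>) / (T * (D * E))"
      using \<gamma>(2) unfolding E_def K_def
      by (simp only: divide_inverse mult_ac inverse_mult_distrib mult_1_left mult_1_right)
    then show ?thesis using T D E by (subst (asm) pos_le_divide_eq) (simp_all add: mult_ac)
  qed
  have "\<exists>a. s + real i * T \<le> a \<and> a \<le> t \<and> h a = h s / \<kappa> ^ i \<and> N a \<le> K * (D * h a)" for i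
  proof (induction i)
    case 0
    have "1 * (D * h s) \<le> K * (D * h s)"
      using K D h(3) by (intro mult_right_mono) auto
    then show ?case using \<open>s \<le> t\<close> N(2) by (intro exI[of _ s]) auto
  next
    case (Suc i)
    then obtain a where a: "s + real i * T \<le> a" "a \<le> t" "h a = h s / \<kappa> ^ i" "N a \<le> K * (D * h a)"
      by blast
    have sa: "s \<le> a" using a(1) T by (smt (verit) mult_nonneg_nonneg of_nat_0_le_iff)
    have ha: "0 < h a" using a(3) h(3) \<kappa> by simp
    have "0 < h a / \<kappa>" using ha \<kappa> by simp
    then have "h t \<le> h a / \<kappa>" using \<open>\<not> 0 < h t\<close> by linarith
    moreover have "h a / \<kappa> \<le> h a" using ha \<kappa> by (simp add: field_simps)
    \<comment> \<open>The next time of the sequence exists because \<open>h\<close> is continuous and drops to a value \<open>\<le> 0\<close> at \<open>t\<close>.\<close>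
    ultimately obtain b where b: "a \<le> b" "b \<le> t" "h b = h a / \<kappa>"
      using IVT2'[of h t "h a / \<kappa>" a] a(2) continuous_on_subset[OF h(1), of "{a..t}"] sa by auto
    have est': "N u \<le> \<beta> (u - a) * N a + D * h a" if "u \<in> {a..b}" for u
    proof -
      have "h b \<le> h u" using that sa b by (intro monotone_onD[OF h(2)]) auto
      moreover have "0 \<le> h b" using b(3) ha \<kappa> by simp
      ultimately show ?thesis using that sa by (intro est) auto
    qed
    have "N u \<le> D * E * h a" if u: "u \<in> {a..b}" for u
    proof -
      have "N u \<le> \<beta> (u - a) * N a + D * h a" by (rule est'[OF u])
      also have "\<beta> (u - a) * N a \<le> \<beta> 0 * N a"
        using u N(1) by (intro mult_right_mono monotone_onD[OF \<beta>(1)]) auto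
      also have "\<beta> 0 * N a \<le> \<beta> 0 * (K * (D * h a))"
        using a(4) \<beta>(2) by (rule mult_left_mono)
      finally show ?thesis by (simp add: E_def algebra_simps)
    qed
    then have "h a - h b \<le> \<gamma> * (D * E * h a * (b - a))"
      using sa b(1) by (intro spend) auto
    then have "((\<kappa> - 1) / \<kappa>) * h a \<le> (\<gamma> * (D * E) * (b - a)) * h a"
      using b(3) \<kappa> by (simp add: field_simps)
    then have "\<gamma> * (D * E) * T \<le> \<gamma> * (D * E) * (b - a)"
      using \<gamma>T ha by (meson mult_le_cancel_right_pos order_trans)
    then have ab: "T \<le> b - a" using \<gamma>(1) D E by simp
    have "N b \<le> \<beta> (b - a) * N a + D * h a" using est'[of b] b(1) by simp
    also have "\<beta> (b - a) * N a \<le> (r / \<kappa>) * N a"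
      using N(1) T ab unfolding \<beta>(3)[symmetric]
      by (intro mult_right_mono monotone_onD[OF \<beta>(1)]) auto
    also have "(r / \<kappa>) * N a \<le> (r / \<kappa>) * (K * (D * h a))"
      using a(4) r \<kappa> by (intro mult_left_mono) auto
    also have "(r / \<kappa>) * (K * (D * h a)) + D * h a = (r * K + \<kappa>) * (D * h b)"
      using b(3) \<kappa> by (simp add: field_simps)
    also have "\<dots> \<le> K * (D * h b)"
      using K(2) D b(3) ha \<kappa> by (intro mult_right_mono) auto
    finally have "N b \<le> K * (D * h b)" by simp
    moreover have "s + real (Suc i) * T \<le> b" using a(1) ab by (simp add: algebra_simps)
    moreover have "h b = h s / \<kappa> ^ Suc i" using a(3) b(3) by simp
    ultimately show ?case using b(2) by blast
  qed
  moreover obtain i where "t - s < real i * T"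
    using T ex_less_of_nat_mult by blast
  ultimately show False by (smt (verit))
qed

section \<open>Limits of integrals of nonnegative functions\<close>

lemma mono_on_bounded_tendsto_at_top:
  fixes \<sigma> :: "real \<Rightarrow> real"
  assumes mono: "mono_on {s..} \<sigma>" and bound: "\<And>t. s \<le> t \<Longrightarrow> \<sigma> t \<le> B"
  obtains L where "(\<sigma> \<longlongrightarrow> L) at_top" "\<sigma> s \<le> L"
proof
  have bdd: "bdd_above (\<sigma> ` {s..})" using bound by (intro bdd_aboveI[of _ B]) auto
  show "\<sigma> s \<le> Sup (\<sigma> ` {s..})" by (rule cSup_upper[OF _ bdd]) simp
  show "(\<sigma> \<longlongrightarrow> Sup (\<sigma> ` {s..})) at_top"
  proof (rule increasing_tendsto)
    show "\<forall>\<^sub>F t in at_top. \<sigma> t \<le> Sup (\<sigma> ` {s..})"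
      using eventually_ge_at_top[of s] by eventually_elim (auto intro: cSup_upper bdd)
    fix y assume "y < Sup (\<sigma> ` {s..})"
    then obtain a where a: "s \<le> a" "y < \<sigma> a" using less_cSup_iff[OF _ bdd, of y] by auto
    show "\<forall>\<^sub>F t in at_top. y < \<sigma> t"
      using eventually_ge_at_top[of a]
      by eventually_elim (use a monotone_onD[OF mono] in \<open>auto intro: less_le_trans\<close>)
  qed
qed

text \<open>A positive limit would make the integral grow linearly.\<close>

lemma nonneg_limit_zero_if_integral_bounded:
  fixes g :: "real \<Rightarrow> real"
  assumes g: "continuous_on {s..} g" "\<And>t. s \<le> t \<Longrightarrow> 0 \<le> g t"
    and bound: "\<And>t. s \<le> t \<Longrightarrow> integral {s..t} g \<le> B"
    and lim: "(g \<longlongrightarrow> y) at_top"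
  shows "y = 0"
proof (rule ccontr)
  assume "y \<noteq> 0"
  have "0 \<le> y"
    by (rule tendsto_lowerbound[OF lim eventually_at_top_linorderI[of s]]) (use g(2) in auto)
  then have "0 < y" using \<open>y \<noteq> 0\<close> by simp
  then have "\<forall>\<^sub>F t in at_top. y / 2 < g t" by (intro order_tendstoD(1)[OF lim]) simp
  then obtain a where a: "\<And>t. a \<le> t \<Longrightarrow> y / 2 < g t"
    by (auto simp: eventually_at_top_linorder)
  define b where "b = max a s"
  \<comment> \<open>Integrating \<open>y / 2\<close> from \<open>b\<close> to this time gives \<open>\<bar>B\<bar> + 1\<close>, which exceeds the bound \<open>B\<close>.\<close>
  define t where "t = b + (\<bar>B\<bar> + 1) / (y / 2)"
  have t: "s \<le> b" "b \<le> t" using \<open>0 < y\<close> by (auto simp: b_def t_def)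
  have int: "g integrable_on {u..v}" if "s \<le> u" for u v
    by (rule integrable_continuous_real, rule continuous_on_subset[OF g(1)]) (use that in auto)
  have "(y / 2) * (t - b) = integral {b..t} (\<lambda>_. y / 2)" using t by simp
  also have "\<dots> \<le> integral {b..t} g"
    by (rule integral_le) (use int t a in \<open>auto simp: b_def less_imp_le\<close>)
  also have "\<dots> \<le> integral {s..t} g"
    by (rule integral_subset_le) (use int t g(2) in auto)
  also have "\<dots> \<le> B" using bound t by auto
  finally show False using \<open>0 < y\<close> by (simp add: t_def)
qed

section \<open>Convergence of the adaptive interconnection\<close>

theorem corollary4:
  fixes f0 :: "real ^ 'n \<Rightarrow> real \<Rightarrow> real ^ 'n"
    and f :: "real ^ 'k \<Rightarrow> real ^ 'd \<Rightarrow> real ^ 'n"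
    and \<xi> :: "(real \<Rightarrow> real ^ 'n) \<Rightarrow> real \<Rightarrow> real ^ 'k"
    and \<epsilon> :: "real \<Rightarrow> real ^ 'n"
    and \<theta> :: "real ^ 'd" and \<Omega>\<^sub>\<theta> :: "(real ^ 'd) set"
    and A :: "(real ^ 'n) set" and \<Delta> \<beta> :: "real \<Rightarrow> real"
    and S :: "real ^ 'l \<Rightarrow> real ^ 'l" and \<phi> :: "real \<Rightarrow> real ^ 'l \<Rightarrow> real ^ 'l"
    and \<Omega>\<^sub>l :: "(real ^ 'l) set" and l0 :: "real ^ 'l"
    and \<eta> :: "real ^ 'l \<Rightarrow> real ^ 'd"
    and t0 \<Delta>\<^sub>\<epsilon> D\<^sub>f \<Delta>\<^sub>f c D\<^sub>\<eta> \<delta> M \<gamma> r \<kappa> D\<^sub>l :: real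
  assumes t0: "t0 \<ge> 0"
    and eps: "L_infty t0 \<epsilon>" "\<And>t. t \<ge> t0 \<Longrightarrow> sup_norm \<epsilon> t0 t \<le> ereal \<Delta>\<^sub>\<epsilon>"
    and Omega_theta: "bounded \<Omega>\<^sub>\<theta>" "\<theta> \<in> \<Omega>\<^sub>\<theta>"
    and f_bound: "D\<^sub>f \<ge> 0" "\<Delta>\<^sub>f \<ge> 0"
      "\<And>x t p q. t \<ge> 0 \<Longrightarrow> p \<in> \<Omega>\<^sub>\<theta> \<Longrightarrow> q \<in> \<Omega>\<^sub>\<theta> \<Longrightarrow>
         norm (f (\<xi> x t) p - f (\<xi> x t) q) \<le> D\<^sub>f * norm (p - q) + \<Delta>\<^sub>f"
    and C4: "input_output_stable f0 A c \<Delta> \<beta>"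
    and C5: "bounded \<Omega>\<^sub>l" "l0 \<in> \<Omega>\<^sub>l" "local_lipschitz (UNIV :: real set) UNIV (\<lambda>_. S)"
      "poisson_stable_dense S \<phi> \<Omega>\<^sub>l l0"
    and C6: "D\<^sub>\<eta>-lipschitz_on UNIV \<eta>" "dense_in (\<eta> ` \<Omega>\<^sub>l) \<Omega>\<^sub>\<theta>"
    and M: "\<delta> > 0" "M = 2 * \<Delta>\<^sub>f + \<Delta>\<^sub>\<epsilon> + \<delta>"
    and C7: "has_steady_state_characteristic (plant_solution f0 f \<xi> \<theta> \<epsilon> t0) t0 \<Omega>\<^sub>\<theta>
               (norm_beyond A (\<Delta> M))"
    and r_kappa: "0 < r" "r < 1" "1 < \<kappa>"
    and D_lambda: "D\<^sub>l = c * D\<^sub>f * D\<^sub>\<eta> * (SUP l\<in>\<Omega>\<^sub>l. norm (S l))"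
    \<comment> \<open>for \<open>D\<^sub>l = 0\<close> the bound on \<open>\<gamma>\<close> is infinite, whereas division by zero yields zero in HOL\<close>
    and gamma: "\<gamma> > 0"
      "D\<^sub>l \<noteq> 0 \<Longrightarrow> \<gamma> \<le> inverse (the_inv_into {0..} \<beta> (r / \<kappa>)) * ((\<kappa> - 1) / \<kappa>) *
                  (1 / (D\<^sub>l * (\<beta> 0 * (1 + \<kappa> / (1 - r)) + 1)))"
  shows "\<forall>x0 x l. x t0 = x0 \<and> l t0 = l0 \<and>
           plant_solution f0 f \<xi> \<theta> \<epsilon> t0 (\<lambda>t. \<eta> (l t)) x \<and>
           solution_on {t0..} (\<lambda>t y. (\<gamma> * norm_beyond A (\<Delta> M) (x t)) *\<^sub>R S y) l \<longrightarrow>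
         ((\<lambda>t. norm_beyond A (\<Delta> M) (x t)) \<longlongrightarrow> 0) at_top \<and>
         (\<exists>\<theta>'\<in>\<Omega>\<^sub>\<theta>. ((\<lambda>t. \<eta> (l t)) \<longlongrightarrow> \<theta>') at_top)"
proof (intro allI impI, elim conjE)
  fix x0 x l
  assume "l t0 = l0" and plant: "plant_solution f0 f \<xi> \<theta> \<epsilon> t0 (\<lambda>t. \<eta> (l t)) x"
    and sol_l: "solution_on {t0..} (\<lambda>t y. (\<gamma> * norm_beyond A (\<Delta> M) (x t)) *\<^sub>R S y) l"
  define N where "N t = norm_beyond A (\<Delta> M) (x t)" for t
  define g where "g t = \<gamma> * N t" for t
  define \<sigma> where "\<sigma> t = integral {t0..t} g" for t
  define V where "V = (SUP l\<in>\<Omega>\<^sub>l. norm (S l))"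
  define T where "T = the_inv_into {0..} \<beta> (r / \<kappa>)"

  have sol_x: "solution_on {t0..}
      (\<lambda>t y. f0 y t + f (\<xi> x t) \<theta> - f (\<xi> x t) (\<eta> (l t)) + \<epsilon> t) x"
    using plant by (simp add: plant_solution_def)
  have N: "continuous_on {t0..} N" "0 \<le> N t" for t
    unfolding N_def
    by (intro continuous_on_norm_beyond solution_on_continuous_on[OF sol_x] norm_beyond_nonneg)+
  have g: "continuous_on {t0..} g" "0 \<le> g t" for t
    unfolding g_def using N gamma(1) by (auto intro!: continuous_intros)
  have int_g: "g integrable_on {a..b}" if "t0 \<le> a" for a b
    by (rule integrable_continuous_real, rule continuous_on_subset[OF g(1)]) (use that in auto)
  have \<sigma>_diff: "\<sigma> b - \<sigma> a = integral {a..b} g" if "t0 \<le> a" "a \<le> b" for a b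
    using Henstock_Kurzweil_Integration.integral_combine[OF that int_g[of t0 b]]
    by (simp add: \<sigma>_def)
  have \<sigma>_mono: "mono_on {t0..} \<sigma>"
  proof (rule monotone_onI)
    fix a b assume "a \<in> {t0..}" "b \<in> {t0..}" "a \<le> b"
    then show "\<sigma> a \<le> \<sigma> b"
      using \<sigma>_diff[of a b] integral_nonneg[OF int_g[of a b] g(2)] by simp
  qed
  have \<sigma>_cont: "continuous_on {t0..} \<sigma>"
    unfolding continuous_on_eq_continuous_within \<sigma>_def
    using indefinite_integral_has_vector_derivative_atLeast[OF g(1)]
    by (auto intro: has_vector_derivative_continuous)
  have \<sigma>0: "\<sigma> t0 = 0" by (simp add: \<sigma>_def)
  have \<sigma>_pos: "0 \<le> \<sigma> t" if "t0 \<le> t" for t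
    using monotone_onD[OF \<sigma>_mono, of t0 t] that \<sigma>0 by simp

  have l_eq: "l t = \<phi> (\<sigma> t) l0" if "t0 \<le> t" for t
    unfolding \<sigma>_def
    by (rule time_scaled_ode_solution_eq_flow[where S=S and l=l and s=t0, OF C5(3,4,2) g _ \<open>l t0 = l0\<close> that])
      (use sol_l in \<open>simp add: g_def N_def\<close>)
  have orbit: "\<phi> t l0 \<in> \<Omega>\<^sub>l" if "0 \<le> t" for t
    using C5(4) that by (simp add: poisson_stable_dense_def)
  have \<eta>_orbit: "\<eta> (\<phi> t l0) \<in> \<Omega>\<^sub>\<theta>" if "0 \<le> t" for t
    using orbit[OF that] C6(2) by (auto simp: dense_in_def)

  have "continuous_on UNIV S"
    using local_lipschitz_continuous_on[OF C5(3)] by simp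
  then have "bounded (S ` closure \<Omega>\<^sub>l)"
    using C5(1) by (intro compact_imp_bounded compact_continuous_image)
      (auto intro: continuous_on_subset simp: compact_closure)
  then obtain B where "\<And>p. p \<in> closure \<Omega>\<^sub>l \<Longrightarrow> norm (S p) \<le> B"
    by (auto simp: bounded_iff)
  then have bdd: "bdd_above ((\<lambda>l. norm (S l)) ` \<Omega>\<^sub>l)"
    using closure_subset by (intro bdd_aboveI2[of _ _ B]) blast
  have V: "norm (S p) \<le> V" if "p \<in> \<Omega>\<^sub>l" for p
    unfolding V_def by (rule cSUP_upper[OF that bdd])
  have V0: "0 \<le> V" using V[OF C5(2)] norm_ge_zero[of "S l0"] by linarith
  have D\<eta>: "0 \<le> D\<^sub>\<eta>" using C6(1) by (rule lipschitz_on_nonneg)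
  have c: "0 < c" and \<beta>0: "1 \<le> \<beta> 0" and \<beta>_lim: "(\<beta> \<longlongrightarrow> 0) at_top"
    and \<beta>_cont: "continuous_on {0..} \<beta>" and \<beta>_anti: "strict_antimono_on {0..} \<beta>"
    using C4 by (auto simp: input_output_stable_def)
  have D\<^sub>l: "0 \<le> D\<^sub>l" "D\<^sub>l = c * (D\<^sub>f * D\<^sub>\<eta> * V)"
    using c f_bound(1) D\<eta> V0 by (auto simp: D_lambda V_def)

  have \<beta>T: "\<beta> T = r / \<kappa>" and T: "0 < T"
  proof -
    have rk: "0 < r / \<kappa>" "r / \<kappa> < 1" using r_kappa by (auto simp: field_simps)
    obtain b where "\<And>t. b \<le> t \<Longrightarrow> \<beta> t < r / \<kappa>"
      using order_tendstoD(2)[OF \<beta>_lim rk(1)] by (auto simp: eventually_at_top_linorder)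
    then obtain b' where "0 \<le> b'" "\<beta> b' \<le> r / \<kappa>"
      by (metis less_imp_le max.cobounded1 max.cobounded2)
    then obtain y where y: "0 \<le> y" "\<beta> y = r / \<kappa>"
      using IVT2'[of \<beta> b' "r / \<kappa>" 0] rk \<beta>0 continuous_on_subset[OF \<beta>_cont, of "{0..b'}"]
      by auto
    have "inj_on \<beta> {0..}" 
      using monotone_onD[OF \<beta>_anti] by (metis inj_onI less_irrefl linorder_less_linear)
    then have "T = y" unfolding T_def using y by (auto intro: the_inv_into_f_eq)
    then show "\<beta> T = r / \<kappa>" "0 < T"
      using y rk \<beta>0 by (auto simp: less_le)
  qed

  \<comment> \<open>If \<open>D\<^sub>l = 0\<close>, the estimates hold with any larger gain; \<open>D = W / \<gamma>\<close> is a positive one for which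
    the bound on \<open>\<gamma>\<close> holds with equality. This makes both cases instances of the small-gain lemma.\<close>
  define W where "W = inverse T * ((\<kappa> - 1) / \<kappa>) / (\<beta> 0 * (1 + \<kappa> / (1 - r)) + 1)"
  obtain D where D: "0 < D" "D\<^sub>l \<le> D" "\<gamma> \<le> W / D"
  proof (cases "D\<^sub>l = 0")
    case True
    have "0 < \<beta> 0 * (1 + \<kappa> / (1 - r)) + 1"
      using \<beta>0 r_kappa by (intro add_nonneg_pos mult_nonneg_nonneg add_nonneg_nonneg) auto
    then have "0 < W" using T r_kappa by (simp add: W_def)
    then show ?thesis using True gamma(1) by (intro that[of "W / \<gamma>"]) auto
  next
    case False
    then show ?thesis
      using D\<^sub>l(1) gamma(2) by (intro that[of D\<^sub>l]) (auto simp: W_def T_def field_simps)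
  qed

  \<comment> \<open>The clock reading \<open>goal\<close>: late enough to dominate the initial error, and with an estimate close
    enough to \<open>\<theta>\<close> for \<open>\<delta>\<close> to absorb the mismatch.\<close>
  obtain goal where goal: "N t0 / D + 1 \<le> goal" "D\<^sub>f * norm (\<theta> - \<eta> (\<phi> goal l0)) \<le> \<delta>"
  proof -
    define e where "e = \<delta> / (D\<^sub>f + 1)"
    have e: "0 < e" "D\<^sub>f * e \<le> \<delta>" using M(1) f_bound(1) by (auto simp: e_def field_simps)
    have "\<theta> \<in> closure (\<eta> ` \<Omega>\<^sub>l)" using Omega_theta(2) C6(2) by (auto simp: dense_in_def)
    then obtain p where p: "p \<in> \<Omega>\<^sub>l" "dist (\<eta> p) \<theta> < e / 2"
      using half_gt_zero[OF e(1)] unfolding closure_approachable by blast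
    have "isCont \<eta> p"
      using lipschitz_on_continuous_on[OF C6(1)] by (simp add: continuous_on_eq_continuous_at)
    then obtain d where d: "0 < d" "\<And>q. dist q p < d \<Longrightarrow> dist (\<eta> q) (\<eta> p) < e / 2"
      using half_gt_zero[OF e(1)] unfolding continuous_at_eps_delta by blast
    obtain t where t: "N t0 / D + 1 \<le> t" "norm (\<phi> t l0 - p) < d"
      using poisson_stable_dense_recurrent[OF C5(3,4,2) p(1) d(1)] by blast
    have "norm (\<theta> - \<eta> (\<phi> t l0)) \<le> e"
      using dist_triangle2[of \<theta> "\<eta> (\<phi> t l0)" "\<eta> p"] d(2)[of "\<phi> t l0"] t(2) p(2)
      by (simp add: dist_norm norm_minus_commute)
    then have "D\<^sub>f * norm (\<theta> - \<eta> (\<phi> t l0)) \<le> \<delta>"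
      using e(2) f_bound(1) by (meson mult_left_mono order_trans)
    with t(1) show ?thesis by (rule that)
  qed

  \<comment> \<open>The time on the clock \<open>\<sigma>\<close> that is left until the estimate is as good as needed.\<close>
  define h where "h t = goal - \<sigma> t" for t
  have h_anti: "antimono_on {t0..} h"
    using \<sigma>_mono by (auto simp: monotone_on_def h_def)
  have h0: "0 < h t0" "N t0 \<le> D * h t0"
  proof -
    have "0 \<le> N t0 / D" using N(2) D(1) by simp
    then show "0 < h t0" using goal(1) by (simp add: h_def \<sigma>0)
    show "N t0 \<le> D * h t0" using goal(1) D(1) by (simp add: h_def \<sigma>0 field_simps)
  qed

  have eps_bound: "norm (\<epsilon> t) \<le> \<Delta>\<^sub>\<epsilon>" if "t0 \<le> t" for t
  proof -
    have "ereal (norm (\<epsilon> t)) \<le> sup_norm \<epsilon> t0 t"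
      unfolding sup_norm_def using that by (intro SUP_upper) simp
    then show ?thesis using eps(2)[OF that] by (metis ereal_less_eq(3) order_trans)
  qed
  then have M0: "0 \<le> M" using M f_bound(2) norm_ge_zero[of "\<epsilon> t0"] by (smt (verit))

  \<comment> \<open>While the clock is between \<open>\<sigma> a\<close> and \<open>goal\<close>, the estimate differs from the one at \<open>goal\<close> by at
    most \<open>D\<^sub>\<eta> V h a\<close>, so the plant input exceeds \<open>M\<close> by at most \<open>D\<^sub>f D\<^sub>\<eta> V h a\<close>.\<close>
  have est: "N t \<le> \<beta> (t - a) * N a + D * h a" if a: "t0 \<le> a" "a \<le> t" and ht: "0 \<le> h t" for a t
  proof -
    have "h t \<le> h a" using monotone_onD[OF h_anti, of a t] a by simp
    then have ha: "0 \<le> h a" using ht by simp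
    define u where "u \<tau> = f (\<xi> x \<tau>) \<theta> - f (\<xi> x \<tau>) (\<eta> (l \<tau>)) + \<epsilon> \<tau>" for \<tau>
    have sol: "solution_on {a..} (\<lambda>t y. f0 y t + u t) x"
      using solution_on_subset[OF sol_x, of "{a..}"] a by (simp add: u_def algebra_simps)
    have u: "norm (u \<tau>) \<le> M + D\<^sub>f * D\<^sub>\<eta> * V * h a" if \<tau>: "\<tau> \<in> {a..t}" for \<tau>
    proof -
      have \<tau>0: "t0 \<le> \<tau>" "0 \<le> \<tau>" using \<tau> a t0 by auto
      have h\<tau>: "0 \<le> h \<tau>" "h \<tau> \<le> h a"
        using monotone_onD[OF h_anti, of \<tau> t] monotone_onD[OF h_anti, of a \<tau>] \<tau> a ht by auto
      have "norm (\<eta> (\<phi> goal l0) - \<eta> (\<phi> (\<sigma> \<tau>) l0)) \<le> D\<^sub>\<eta> * norm (\<phi> goal l0 - \<phi> (\<sigma> \<tau>) l0)"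
        using lipschitz_onD[OF C6(1)] by (simp add: dist_norm)
      also have "\<dots> \<le> D\<^sub>\<eta> * (V * h \<tau>)"
        using poisson_stable_dense_flow_speed[OF C5(3,4,2) V \<sigma>_pos[OF \<tau>0(1)], of goal] h\<tau>(1) D\<eta>
        by (intro mult_left_mono) (auto simp: h_def)
      also have "\<dots> \<le> D\<^sub>\<eta> * (V * h a)"
        using h\<tau> D\<eta> V0 by (intro mult_left_mono) auto
      finally have "norm (\<theta> - \<eta> (l \<tau>)) \<le> norm (\<theta> - \<eta> (\<phi> goal l0)) + D\<^sub>\<eta> * (V * h a)"
        using norm_triangle_ineq[of "\<theta> - \<eta> (\<phi> goal l0)" "\<eta> (\<phi> goal l0) - \<eta> (l \<tau>)"]
        by (simp add: l_eq[OF \<tau>0(1)])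
      then have "D\<^sub>f * norm (\<theta> - \<eta> (l \<tau>)) \<le> D\<^sub>f * (norm (\<theta> - \<eta> (\<phi> goal l0)) + D\<^sub>\<eta> * (V * h a))"
        using f_bound(1) by (rule mult_left_mono)
      also have "\<dots> \<le> \<delta> + D\<^sub>f * D\<^sub>\<eta> * V * h a"
        using goal(2) by (simp add: algebra_simps)
      finally have "norm (f (\<xi> x \<tau>) \<theta> - f (\<xi> x \<tau>) (\<eta> (l \<tau>))) \<le> \<delta> + D\<^sub>f * D\<^sub>\<eta> * V * h a + \<Delta>\<^sub>f"
        using f_bound(3)[OF \<tau>0(2) Omega_theta(2) \<eta>_orbit[OF \<sigma>_pos[OF \<tau>0(1)]], of x]
        by (simp add: l_eq[OF \<tau>0(1)])
      then show ?thesis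
        unfolding u_def M(2)
        using norm_triangle_le[of _ "\<epsilon> \<tau>"] eps_bound[OF \<tau>0(1)] f_bound(2) by (smt (verit))
    qed
    have "N t \<le> \<beta> (t - a) * N a + c * (D\<^sub>f * D\<^sub>\<eta> * V * h a)"
      unfolding N_def
      by (rule input_output_stable_estimate[OF C4 sol u M0])
        (use a t0 ha f_bound(1) D\<eta> V0 in auto)
    also have "c * (D\<^sub>f * D\<^sub>\<eta> * V * h a) = D\<^sub>l * h a" by (simp add: D\<^sub>l(2))
    also have "\<dots> \<le> D * h a" using D(2) ha by (rule mult_right_mono)
    finally show ?thesis by simp
  qed

  have spend: "h a - h b \<le> \<gamma> * (m * (b - a))"
    if ab: "t0 \<le> a" "a \<le> b" and m: "\<And>t. t \<in> {a..b} \<Longrightarrow> N t \<le> m" for a b m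
  proof -
    have "h a - h b = integral {a..b} g" using \<sigma>_diff[OF ab] by (simp add: h_def)
    also have "\<dots> \<le> integral {a..b} (\<lambda>_. \<gamma> * m)"
      by (rule integral_le) (use int_g ab m gamma(1) in \<open>auto simp: g_def\<close>)
    also have "\<dots> = \<gamma> * (m * (b - a))" using ab by simp
    finally show ?thesis .
  qed

  have h_pos: "0 < h t" if "t0 \<le> t" for t
  proof (rule small_gain_budget_not_exhausted[where N=N and \<beta>=\<beta>, OF _ h_anti h0(1) spend est N(2) h0(2)
        _ _ \<beta>T T r_kappa D(1) gamma(1) _ that])
    show "continuous_on {t0..} h" unfolding h_def by (intro continuous_intros \<sigma>_cont)
    show "antimono_on {0..} \<beta>" 
      using monotone_onD[OF \<beta>_anti] by (intro monotone_onI) (metis less_imp_le order_le_less)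
    show "0 \<le> \<beta> 0" using \<beta>0 by simp
    show "\<gamma> \<le> inverse T * ((\<kappa> - 1) / \<kappa>) * (1 / (D * (\<beta> 0 * (1 + \<kappa> / (1 - r)) + 1)))"
      using D(3) by (simp add: W_def mult_ac)
  qed
  then have \<sigma>_bound: "\<sigma> t \<le> goal" if "t0 \<le> t" for t
    using that by (simp add: h_def less_imp_le)
  obtain L where L: "(\<sigma> \<longlongrightarrow> L) at_top" "0 \<le> L"
    using mono_on_bounded_tendsto_at_top[OF \<sigma>_mono \<sigma>_bound] \<sigma>0 by metis

  have "continuous_on {0..} (\<lambda>t. \<phi> t l0)"
    using C5(2,4) by (intro solution_on_continuous_on[of _ "\<lambda>_. S"]) (simp add: poisson_stable_dense_def)
  then have "continuous_on {0..} (\<lambda>t. \<eta> (\<phi> t l0))"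
    using continuous_on_compose2[OF lipschitz_on_continuous_on[OF C6(1)]] by auto
  then have "((\<lambda>t. \<eta> (\<phi> (\<sigma> t) l0)) \<longlongrightarrow> \<eta> (\<phi> L l0)) at_top"
    by (rule continuous_on_tendsto_compose[OF _ L(1)])
      (use L(2) \<sigma>_pos in \<open>auto intro: eventually_at_top_linorderI[of t0]\<close>)
  then have lim_\<theta>: "((\<lambda>t. \<eta> (l t)) \<longlongrightarrow> \<eta> (\<phi> L l0)) at_top"
    by (rule Lim_transform_eventually)
      (auto intro: eventually_at_top_linorderI[of t0] simp: l_eq)
  have "\<forall>t\<ge>t0. \<eta> (l t) \<in> \<Omega>\<^sub>\<theta>" using \<eta>_orbit \<sigma>_pos by (simp add: l_eq)
  then obtain y where y: "(N \<longlongrightarrow> y) at_top"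
    using C7 \<eta>_orbit[OF L(2)] lim_\<theta> plant
    unfolding has_steady_state_characteristic_def N_def by metis
  have "(g \<longlongrightarrow> \<gamma> * y) at_top" unfolding g_def by (intro tendsto_intros y)
  from nonneg_limit_zero_if_integral_bounded[OF g _ this, of goal]
  have "y = 0" using \<sigma>_bound gamma(1) by (simp add: \<sigma>_def)
  with y have "((\<lambda>t. norm_beyond A (\<Delta> M) (x t)) \<longlongrightarrow> 0) at_top" unfolding N_def by simp
  with lim_\<theta> \<eta>_orbit[OF L(2)]
  show "((\<lambda>t. norm_beyond A (\<Delta> M) (x t)) \<longlongrightarrow> 0) at_top \<and>
      (\<exists>\<theta>'\<in>\<Omega>\<^sub>\<theta>. ((\<lambda>t. \<eta> (l t)) \<longlongrightarrow> \<theta>') at_top)" by blast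
qed

end
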